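(* Let $n\ge1$. The map $\rho:\mathcal T(n)\to\mathcal T(n)$ described in the context is an involution which exchanges $\deg(0)$ and $\deg(p)$ while preserving the set of children of every other vertex: for every $T\in\mathcal T(n)$, with $p_T$ denoting the parent of vertex $1$ in $T$, $C_T(v)$ the set of children of $v$ in $T$ and $\deg_T(v)=|C_T(v)|$, $$\deg_{\rho(T)}(0)=\deg_T(p_T),\qquad \deg_{\rho(T)}(p_{\rho(T)})=\deg_T(0),$$ and $C_{\rho(T)}(v)=C_T(v)$ for every vertex $v\notin\{0,p_T\}$.
   Context: $\mathcal T(n)$ is the set of trees on the vertex set $\{0,1,\dots,n\}$, rooted at $0$. The map $\rho$: given $T\in\mathcal T(n)$, let $p$ be the parent of vertex $1$. If $p=0$, set $\rho(T)=T$. If $p\ne 0$, let $0-q-\cdots-p-1$ be the path from $0$ to $1$ (possibly $q=p$), let $t_1,\dots,t_c$ be the children of $0$ other than $q$ and $s_1,\dots,s_d$ the children of $p$ other than $1$; then $\rho(T)$ is obtained by replacing each edge $(0,t_i)$ with $(p,t_i)$, replacing each edge $(p,s_i)$ with $(0,s_i)$, and keeping all other edges. *)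

theory Defs
  imports Main
begin

text \<open>
  An undirected simple graph is given by a vertex set \<open>V\<close> and a set \<open>E\<close> of two-element
  subsets of \<open>V\<close>.  The tree relation of the Graph Theory entry is not usable
  here: a directed graph with symmetric arcs has the 2-cycle \<open>u, v, u\<close> for every edge.
\<close>

definition simple_graph :: "'a set \<Rightarrow> 'a set set \<Rightarrow> bool" where
  "simple_graph V E \<longleftrightarrow> (\<forall>e\<in>E. e \<subseteq> V \<and> card e = 2)"

text \<open>Paths are lists of pairwise distinct vertices; the list \<open>[u]\<close> is the path from \<open>u\<close> to \<open>u\<close>.\<close>

definition is_path :: "'a set set \<Rightarrow> 'a list \<Rightarrow> bool" where
  "is_path E xs \<longleftrightarrow>
     xs \<noteq> [] \<and> distinct xs \<and> (\<forall>i. Suc i < length xs \<longrightarrow> {xs ! i, xs ! Suc i} \<in> E)"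

definition path_from_to :: "'a set set \<Rightarrow> 'a \<Rightarrow> 'a list \<Rightarrow> 'a \<Rightarrow> bool" where
  "path_from_to E u xs v \<longleftrightarrow> is_path E xs \<and> hd xs = u \<and> last xs = v"

definition is_cycle :: "'a set set \<Rightarrow> 'a list \<Rightarrow> bool" where
  "is_cycle E xs \<longleftrightarrow> is_path E xs \<and> 3 \<le> length xs \<and> {last xs, hd xs} \<in> E"

definition is_tree :: "'a set \<Rightarrow> 'a set set \<Rightarrow> bool" where
  "is_tree V E \<longleftrightarrow>
     V \<noteq> {} \<and> simple_graph V E \<and>
     (\<forall>u\<in>V. \<forall>v\<in>V. \<exists>xs. path_from_to E u xs v) \<and>
     (\<nexists>xs. is_cycle E xs)"

definition trees :: "nat \<Rightarrow> nat set set set" where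
  "trees n = {T. is_tree {0..n} T}"

text \<open>The unique path from the root \<open>0\<close> to \<open>v\<close>, both ends included.\<close>

definition root_path :: "nat set set \<Rightarrow> nat \<Rightarrow> nat list" where
  "root_path T v = (THE xs. path_from_to T 0 xs v)"

text \<open>Only meaningful for \<open>v \<noteq> 0\<close>, when the root path has at least two vertices.\<close>

definition parent :: "nat set set \<Rightarrow> nat \<Rightarrow> nat" where
  "parent T v = root_path T v ! (length (root_path T v) - 2)"

definition children :: "nat set set \<Rightarrow> nat \<Rightarrow> nat set" where
  "children T v = {w. w \<noteq> 0 \<and> {v, w} \<in> T \<and> parent T w = v}"

definition deg :: "nat set set \<Rightarrow> nat \<Rightarrow> nat" where
  "deg T v = card (children T v)"

definition rho :: "nat set set \<Rightarrow> nat set set" where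
  "rho T =
     (let p = parent T 1 in
      if p = 0 then T
      else
        let q = root_path T 1 ! 1;
            A = children T 0 - {q};
            B = children T p - {1}
        in (T - ({{0, t} | t. t \<in> A} \<union> {{p, s} | s. s \<in> B}))
             \<union> ({{p, t} | t. t \<in> A} \<union> {{0, s} | s. s \<in> B}))"

end

theory Submission
  imports Defs
begin

text \<open>
  A tree on \<open>{0..n}\<close> rooted at \<open>0\<close> is the same thing as a parent function: a map \<open>f\<close> on
  \<open>{1..n}\<close> such that iterating \<open>f\<close> leads from every vertex to \<open>0\<close>.  In one direction a parent
  function yields the edge set \<open>{{f w, w} | w}\<close>, whose root paths are exactly the chains of
  iterated parents, so that \<open>parent\<close> recovers \<open>f\<close> (\<open>parent_edges_tree\<close>, \<open>parent_parent_edges\<close>).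
  In the other direction every tree arises in this way (\<open>tree_has_parent_function\<close>).

  If vertex \<open>1\<close> is a child of \<open>0\<close>, nothing happens.  Otherwise \<open>rho\<close> merely exchanges two parents, up to two exceptions:
  with \<open>p = f 1\<close> and \<open>q\<close> the second vertex of the path from \<open>0\<close> to \<open>1\<close>, the vertices with
  parent \<open>0\<close> get parent \<open>p\<close> and conversely, except that \<open>q\<close> stays below \<open>0\<close> and \<open>1\<close> stays
  below \<open>p\<close> (\<open>rho_parent_edges\<close>).  The path from \<open>0\<close> to \<open>1\<close> meets the children of \<open>0\<close>
  only in \<open>q\<close> and the children of \<open>p\<close> only in \<open>1\<close>, hence it survives.  Therefore \<open>p\<close> still leads to
  \<open>0\<close>, and so does every vertex, which makes the result a tree again
  (\<open>rooted_swap_children\<close>).  Moreover \<open>p\<close> and \<open>q\<close> are the same for the new tree, so the second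
  application swaps the same two families back (\<open>swap_children_involution\<close>).  The degree statements
  are read off from the new parent function: \<open>0\<close> keeps the one child \<open>q\<close> and takes over all
  children of \<open>p\<close> but \<open>1\<close>, while \<open>p\<close> keeps \<open>1\<close> and takes over all children of \<open>0\<close> but \<open>q\<close>.
\<close>

section \<open>Parent functions\<close>

definition root_chain :: "nat \<Rightarrow> (nat \<Rightarrow> nat) \<Rightarrow> nat list \<Rightarrow> bool" where
  "root_chain n f xs \<longleftrightarrow> xs \<noteq> [] \<and> hd xs = 0 \<and>
     (\<forall>i. Suc i < length xs \<longrightarrow> xs ! Suc i \<in> {1..n} \<and> f (xs ! Suc i) = xs ! i)"

definition rooted :: "nat \<Rightarrow> (nat \<Rightarrow> nat) \<Rightarrow> bool" where
  "rooted n f \<longleftrightarrow> (\<forall>v\<in>{0..n}. \<exists>xs. root_chain n f xs \<and> last xs = v)"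

definition parent_edges :: "nat \<Rightarrow> (nat \<Rightarrow> nat) \<Rightarrow> nat set set" where
  "parent_edges n f = (\<lambda>w. {f w, w}) ` {1..n}"

lemma parent_edgesI: "w \<in> {1..n} \<Longrightarrow> {f w, w} \<in> parent_edges n f"
  unfolding parent_edges_def by blast

text \<open>
  Root chains and graph paths are both conditions on consecutive entries; this common step gives
  induction from the far end for both.
\<close>

lemma nth_step_snoc:
  assumes "xs \<noteq> []"
  shows "(\<forall>i. Suc i < length (xs @ [w]) \<longrightarrow> P ((xs @ [w]) ! i) ((xs @ [w]) ! Suc i)) \<longleftrightarrow>
    (\<forall>i. Suc i < length xs \<longrightarrow> P (xs ! i) (xs ! Suc i)) \<and> P (last xs) w" (is "?L \<longleftrightarrow> ?R")
proof
  assume L: ?L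
  have "P (xs ! i) (xs ! Suc i)" if "Suc i < length xs" for i
    using L[rule_format, of i] that by (simp add: nth_append)
  moreover have "P (last xs) w"
    using L[rule_format, of "length xs - 1"] assms by (simp add: nth_append last_conv_nth)
  ultimately show ?R by blast
next
  assume R: ?R
  show ?L
  proof (intro allI impI)
    fix i assume i: "Suc i < length (xs @ [w])"
    show "P ((xs @ [w]) ! i) ((xs @ [w]) ! Suc i)"
    proof (cases "Suc i < length xs")
      case True
      then show ?thesis using R by (simp add: nth_append)
    next
      case False
      then have "length xs = Suc i" using i by simp
      then show ?thesis using R assms by (simp add: nth_append last_conv_nth)
    qed
  qed
qed

lemma root_chain_single [simp]: "root_chain n f [x] \<longleftrightarrow> x = 0"
  by (simp add: root_chain_def)

lemma root_chain_snoc: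
  assumes "xs \<noteq> []"
  shows "root_chain n f (xs @ [w]) \<longleftrightarrow> root_chain n f xs \<and> w \<in> {1..n} \<and> f w = last xs"
  using nth_step_snoc[OF assms, of w "\<lambda>a b. b \<in> {1..n} \<and> f b = a"] assms
  unfolding root_chain_def by auto

lemma root_chain_prefix: "root_chain n f (xs @ ys) \<Longrightarrow> xs \<noteq> [] \<Longrightarrow> root_chain n f xs"
proof (induction ys rule: rev_induct)
  case (snoc y ys)
  then show ?case using root_chain_snoc[of "xs @ ys" n f y] by simp
qed simp

text \<open>A chain is determined from its last vertex backwards, since each predecessor is a value of \<open>f\<close>.\<close>

lemma root_chain_unique:
  "root_chain n f xs \<Longrightarrow> root_chain n f ys \<Longrightarrow> last xs = last ys \<Longrightarrow> xs = ys"
proof (induction xs arbitrary: ys rule: rev_induct)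
  case Nil
  then show ?case by (simp add: root_chain_def)
next
  case (snoc x xs)
  have "ys \<noteq> []" using snoc.prems by (simp add: root_chain_def)
  then obtain zs where ys: "ys = zs @ [x]"
    using snoc.prems(3) by (metis append_butlast_last_id last_snoc)
  show ?case
  proof (cases "xs = [] \<or> zs = []")
    case True
    then show ?thesis using snoc.prems ys root_chain_snoc[of xs n f x] root_chain_snoc[of zs n f x]
      by (cases "xs = []"; cases "zs = []") auto
  next
    case False
    then have "root_chain n f xs" "root_chain n f zs" "last xs = last zs"
      using snoc.prems ys root_chain_snoc[of xs n f x] root_chain_snoc[of zs n f x] by auto
    then show ?thesis using snoc.IH ys by simp
  qed
qed

text \<open>
  If the last vertex occurred earlier, the prefix ending there would be a second, shorter chain to
  the same vertex.
\<close>

lemma root_chain_distinct: "root_chain n f xs \<Longrightarrow> distinct xs"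
proof (induction xs rule: rev_induct)
  case (snoc x xs)
  show ?case
  proof (cases "xs = []")
    case False
    have "x \<notin> set xs"
    proof
      assume "x \<in> set xs"
      then obtain us vs where xs: "xs = us @ x # vs" by (meson split_list)
      then have "root_chain n f ((us @ [x]) @ (vs @ [x]))" using snoc.prems by simp
      then have "root_chain n f (us @ [x])" by (rule root_chain_prefix) simp
      then have "us @ [x] = xs @ [x]"
        using snoc.prems by (intro root_chain_unique[of n f]) auto
      then show False using xs by simp
    qed
    then show ?thesis using snoc False root_chain_snoc by simp
  qed simp
qed simp

text \<open>
  The depth of a vertex, that is the length of its chain, decreases towards the root.  Together with
  \<open>rank_imp_rooted\<close> this makes rootedness a well-foundedness property.
\<close>

lemma rooted_imp_rank:
  assumes "rooted n f"
  shows "\<exists>d :: nat \<Rightarrow> nat. \<forall>w\<in>{1..n}. f w \<in> {0..n} \<and> d (f w) < d w"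
proof -
  obtain c where c: "\<And>v. v \<in> {0..n} \<Longrightarrow> root_chain n f (c v) \<and> last (c v) = v"
    using assms unfolding rooted_def by metis
  have "f w \<in> {0..n} \<and> length (c (f w)) < length (c w)" if w: "w \<in> {1..n}" for w
  proof -
    have cw: "root_chain n f (c w)" "last (c w) = w" using c[of w] w by auto
    then have "c w \<noteq> []" by (simp add: root_chain_def)
    then obtain xs where xs: "c w = xs @ [w]" using cw by (metis append_butlast_last_id)
    have "xs \<noteq> []" using cw w xs by auto
    then have r: "root_chain n f xs" "f w = last xs" using cw xs root_chain_snoc by auto
    have "last xs \<in> {0..n}"
    proof (cases xs rule: rev_cases)
      case (snoc zs z)
      then show ?thesis using r root_chain_snoc[of zs n f z] by (cases "zs = []") auto
    qed (use \<open>xs \<noteq> []\<close> in simp)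
    then have "f w \<in> {0..n}" using r by simp
    moreover have "c (f w) = xs"
      using c[OF \<open>f w \<in> {0..n}\<close>] r by (intro root_chain_unique[of n f]) auto
    ultimately show ?thesis using xs by simp
  qed
  then show ?thesis by (intro exI[of _ "\<lambda>v. length (c v)"]) blast
qed

lemma rooted_step:
  assumes "root_chain n f xs" "last xs = f w" "w \<in> {1..n}"
  shows "\<exists>ys. root_chain n f ys \<and> last ys = w"
proof -
  have "root_chain n f (xs @ [w])"
    using assms root_chain_snoc[of xs n f w] by (auto simp: root_chain_def)
  then show ?thesis by force
qed

lemma rank_imp_rooted:
  fixes d :: "nat \<Rightarrow> nat"
  assumes "\<And>w. w \<in> {1..n} \<Longrightarrow> f w \<in> {0..n} \<and> d (f w) < d w"
  shows "rooted n f"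
proof -
  have "v \<in> {0..n} \<Longrightarrow> \<exists>xs. root_chain n f xs \<and> last xs = v" for v
  proof (induction v rule: measure_induct_rule[of d])
    case (less v)
    show ?case
    proof (cases "v = 0")
      case True
      then have "root_chain n f [0] \<and> last [0] = v" by simp
      then show ?thesis by blast
    next
      case False
      then have v: "v \<in> {1..n}" using less.prems by auto
      then obtain xs where "root_chain n f xs" "last xs = f v" using less.IH assms by metis
      then show ?thesis using rooted_step v by blast
    qed
  qed
  then show ?thesis unfolding rooted_def by blast
qed

section \<open>Paths in graphs\<close>

lemma is_path_snoc:
  assumes "xs \<noteq> []"
  shows "is_path E (xs @ [w]) \<longleftrightarrow> is_path E xs \<and> w \<notin> set xs \<and> {last xs, w} \<in> E"
  using nth_step_snoc[OF assms, of w "\<lambda>a b. {a, b} \<in> E"] assms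
  unfolding is_path_def by auto

lemma is_path_single [simp]: "is_path E [x]"
  by (simp add: is_path_def)

lemma is_path_prefix: "is_path E (xs @ ys) \<Longrightarrow> xs \<noteq> [] \<Longrightarrow> is_path E xs"
proof (induction ys rule: rev_induct)
  case (snoc y ys)
  then show ?case using is_path_snoc[of "xs @ ys" E y] by simp
qed simp

lemma is_path_mono: "is_path E xs \<Longrightarrow> E \<subseteq> F \<Longrightarrow> is_path F xs"
  unfolding is_path_def by blast

lemma is_path_rev:
  assumes "is_path E xs"
  shows "is_path E (rev xs)"
proof -
  have "{rev xs ! i, rev xs ! Suc i} \<in> E" if i: "Suc i < length xs" for i
  proof -
    define j where "j = length xs - Suc (Suc i)"
    have "Suc j < length xs" "rev xs ! i = xs ! Suc j" "rev xs ! Suc i = xs ! j"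
      using i by (auto simp: j_def rev_nth Suc_diff_Suc)
    then show ?thesis using assms by (simp add: is_path_def insert_commute)
  qed
  then show ?thesis using assms by (simp add: is_path_def)
qed

lemma path_exists_extend:
  assumes "path_from_to E u xs v" "{v, w} \<in> E"
  shows "\<exists>ys. path_from_to E u ys w"
proof (cases "w \<in> set xs")
  case True
  then obtain us vs where "xs = (us @ [w]) @ vs" by (metis split_list append_Cons append_Nil append_assoc)
  then have "path_from_to E u (us @ [w]) w"
    using assms is_path_prefix[of E "us @ [w]" vs]
    by (auto simp: path_from_to_def hd_append split: if_splits)
  then show ?thesis by blast
next
  case False
  have "xs \<noteq> []" using assms by (auto simp: path_from_to_def is_path_def)
  then have "path_from_to E u (xs @ [w]) w"
    using assms False by (simp add: path_from_to_def is_path_snoc)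
  then show ?thesis by blast
qed

lemma path_from_to_rev: "path_from_to E u xs v \<Longrightarrow> path_from_to E v (rev xs) u"
  using is_path_rev by (auto simp: path_from_to_def hd_rev last_rev)

section \<open>From parent functions to trees\<close>

text \<open>Every vertex is joined to \<open>0\<close> by its chain, and \<open>path_exists_extend\<close> absorbs any repetition.\<close>

lemma parent_edges_connected:
  assumes "rooted n f" "u \<in> {0..n}" "v \<in> {0..n}"
  shows "\<exists>xs. path_from_to (parent_edges n f) u xs v"
proof -
  let ?E = "parent_edges n f"
  have reach: "\<exists>ys. path_from_to ?E u ys (last xs)"
    if "root_chain n f xs" "\<exists>ys. path_from_to ?E u ys 0" for u xs
    using that
  proof (induction xs rule: rev_induct)
    case Nil
    then show ?case by (simp add: root_chain_def)
  next
    case (snoc x xs)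
    show ?case
    proof (cases "xs = []")
      case True
      then show ?thesis using snoc.prems by simp
    next
      case False
      then have r: "root_chain n f xs" "x \<in> {1..n}" "f x = last xs"
        using snoc.prems root_chain_snoc by auto
      then have "{last xs, x} \<in> ?E" using parent_edgesI[OF r(2), of f] by simp
      then show ?thesis using snoc.IH[OF r(1) snoc.prems(2)] path_exists_extend by fastforce
    qed
  qed
  obtain xs ys where c: "root_chain n f xs" "last xs = u" "root_chain n f ys" "last ys = v"
    using assms unfolding rooted_def by metis
  have "path_from_to ?E 0 [0] 0" by (simp add: path_from_to_def)
  then have "\<exists>zs. path_from_to ?E 0 zs u" using reach c(1,2) by blast
  then have "\<exists>zs. path_from_to ?E u zs 0" by (meson path_from_to_rev)
  then show ?thesis using reach c(3,4) by blast
qed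

text \<open>
  A deepest vertex of a cycle has two neighbours on it that are no deeper.  The only neighbour of
  a vertex \<open>x\<close> with this property is \<open>f x\<close>, so the two neighbours coincide.
\<close>

lemma parent_edges_acyclic:
  assumes "rooted n f"
  shows "\<not> is_cycle (parent_edges n f) xs"
proof
  assume cyc: "is_cycle (parent_edges n f) xs"
  obtain d :: "nat \<Rightarrow> nat" where d: "\<And>w. w \<in> {1..n} \<Longrightarrow> f w \<in> {0..n} \<and> d (f w) < d w"
    using rooted_imp_rank[OF assms] by blast
  have low: "y = f x" if "{x, y} \<in> parent_edges n f" "d y \<le> d x" for x y
    using that d by (fastforce simp: parent_edges_def doubleton_eq_iff)
  let ?l = "length xs"
  have l: "3 \<le> ?l" and dist: "distinct xs" using cyc by (auto simp: is_cycle_def is_path_def)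
  have "xs \<noteq> []" using l by auto
  have step: "{xs ! i, xs ! Suc i} \<in> parent_edges n f" if "Suc i < ?l" for i
    using that cyc by (simp add: is_cycle_def is_path_def)
  have close: "{xs ! (?l - 1), xs ! 0} \<in> parent_edges n f"
    using cyc \<open>xs \<noteq> []\<close> by (simp add: is_cycle_def last_conv_nth hd_conv_nth)
  obtain x where x: "x \<in> set xs" "\<And>y. y \<in> set xs \<Longrightarrow> d y \<le> d x"
  proof -
    have "Max (d ` set xs) \<in> d ` set xs" using \<open>xs \<noteq> []\<close> by (intro Max_in) auto
    then obtain x where "x \<in> set xs" "Max (d ` set xs) = d x" by blast
    then show ?thesis using that[of x] by (metis List.finite_set Max_ge finite_imageI imageI)
  qed
  obtain i where i: "i < ?l" "x = xs ! i" using x(1) by (metis in_set_conv_nth)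
  \<comment> \<open>The cyclic successor and predecessor of \<open>i\<close>; they differ because the length is at least 3.\<close>
  define j k where "j = (if Suc i = ?l then 0 else Suc i)" and "k = (if i = 0 then ?l - 1 else i - 1)"
  have jk: "j < ?l" "k < ?l" "j \<noteq> k" using i(1) l by (auto simp: j_def k_def)
  have "Suc i = ?l \<Longrightarrow> i = ?l - 1" by simp
  then have "{x, xs ! j} \<in> parent_edges n f"
    using step[of i] close i by (auto simp: j_def)
  moreover have "{x, xs ! k} \<in> parent_edges n f"
    using step[of "i - 1"] close i by (auto simp: k_def insert_commute)
  ultimately have "xs ! j = xs ! k" using low x(2) jk by (metis nth_mem)
  then show False using dist jk by (simp add: nth_eq_iff_index_eq)
qed

lemma parent_edges_tree:
  assumes "rooted n f"
  shows "parent_edges n f \<in> trees n"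
proof -
  obtain d :: "nat \<Rightarrow> nat" where d: "\<And>w. w \<in> {1..n} \<Longrightarrow> f w \<in> {0..n} \<and> d (f w) < d w"
    using rooted_imp_rank[OF assms] by blast
  have "e \<subseteq> {0..n} \<and> card e = 2" if e: "e \<in> parent_edges n f" for e
  proof -
    obtain w where w: "w \<in> {1..n}" "e = {f w, w}"
      using e unfolding parent_edges_def by blast
    then have "f w \<noteq> w" using d[of w] by auto
    then show ?thesis using w d[of w] by (auto simp: card_2_iff)
  qed
  then show ?thesis
    using parent_edges_connected[OF assms] parent_edges_acyclic[OF assms]
    unfolding trees_def is_tree_def simple_graph_def by auto
qed

text \<open>
  A path leaving the root never turns back towards it: along a chain ending in \<open>x\<close> the vertex
  \<open>f x\<close> has just been visited, so the next edge must lead from a parent to its child.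
  This is where uniqueness of root paths comes from.
\<close>

lemma path_is_root_chain:
  "is_path (parent_edges n f) xs \<Longrightarrow> hd xs = 0 \<Longrightarrow> root_chain n f xs"
proof (induction xs rule: rev_induct)
  case Nil
  then show ?case by (simp add: is_path_def)
next
  case (snoc w xs)
  show ?case
  proof (cases "xs = []")
    case True
    then show ?thesis using snoc.prems by simp
  next
    case False
    then have p: "is_path (parent_edges n f) xs" "w \<notin> set xs" "{last xs, w} \<in> parent_edges n f"
      using snoc.prems by (auto simp: is_path_snoc)
    have c: "root_chain n f xs" using snoc False p(1) by simp
    obtain x where x: "x \<in> {1..n}" "{last xs, w} = {f x, x}" using p(3) by (auto simp: parent_edges_def)
    have "x \<noteq> last xs"
    proof
      assume xl: "x = last xs"
      then have w: "w = f x" using x(2) by (auto simp: doubleton_eq_iff)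
      obtain ys where ys: "xs = ys @ [x]" using xl False by (metis append_butlast_last_id)
      have "ys \<noteq> []" using c ys x(1) by auto
      then have "w \<in> set xs" using c ys w root_chain_snoc[of ys n f x] by simp
      then show False using p(2) by simp
    qed
    then have "w = x" "f x = last xs" using x(2) by (auto simp: doubleton_eq_iff)
    then show ?thesis using c x(1) False root_chain_snoc by simp
  qed
qed

lemma root_chain_is_path:
  assumes "root_chain n f xs"
  shows "is_path (parent_edges n f) xs"
proof -
  have "{xs ! i, xs ! Suc i} \<in> parent_edges n f" if "Suc i < length xs" for i
  proof -
    have "xs ! Suc i \<in> {1..n}" "xs ! i = f (xs ! Suc i)"
      using assms that by (simp_all add: root_chain_def)
    then show ?thesis using parent_edgesI by simp
  qed
  then show ?thesis
    using assms root_chain_distinct[OF assms] by (simp add: root_chain_def is_path_def)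
qed

lemma root_path_parent_edges:
  assumes "root_chain n f xs"
  shows "root_path (parent_edges n f) (last xs) = xs"
  unfolding root_path_def
proof (rule the_equality)
  show "path_from_to (parent_edges n f) 0 xs (last xs)"
    using assms root_chain_is_path by (simp add: path_from_to_def root_chain_def)
next
  fix ys
  assume "path_from_to (parent_edges n f) 0 ys (last xs)"
  then show "ys = xs"
    using path_is_root_chain root_chain_unique assms by (metis path_from_to_def)
qed

lemma root_chain_penultimate:
  assumes "root_chain n f xs" "last xs = w" "w \<noteq> 0"
  shows "Suc 0 < length xs" "w \<in> {1..n}" "xs ! (length xs - 2) = f w" "xs ! (length xs - 1) = w"
proof -
  have ne: "xs \<noteq> []" "hd xs = 0" using assms(1) by (auto simp: root_chain_def)
  show w: "xs ! (length xs - 1) = w" using ne assms(2) by (simp add: last_conv_nth)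
  show l: "Suc 0 < length xs"
  proof (rule ccontr)
    assume "\<not> Suc 0 < length xs"
    then have "length xs - 1 = 0" by simp
    then show False using w ne assms(3) by (simp add: hd_conv_nth)
  qed
  then have *: "Suc (length xs - 2) = length xs - 1" by simp
  then have "xs ! (length xs - 1) \<in> {1..n} \<and> f (xs ! (length xs - 1)) = xs ! (length xs - 2)"
    using assms(1) l unfolding root_chain_def
    by (metis One_nat_def Suc_lessD diff_less zero_less_Suc)
  then show "w \<in> {1..n}" "xs ! (length xs - 2) = f w" using w by auto
qed

lemma parent_parent_edges:
  assumes "rooted n f" "w \<in> {1..n}"
  shows "parent (parent_edges n f) w = f w"
proof -
  obtain xs where xs: "root_chain n f xs" "last xs = w"
    using assms unfolding rooted_def by (metis atLeastAtMost_iff zero_le)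
  then have "root_path (parent_edges n f) w = xs" using root_path_parent_edges by blast
  then show ?thesis using root_chain_penultimate(3)[OF xs] assms(2) by (simp add: parent_def)
qed

lemma children_parent_edges:
  assumes "rooted n f"
  shows "children (parent_edges n f) v = {w \<in> {1..n}. f w = v}"
proof -
  obtain d :: "nat \<Rightarrow> nat" where d: "\<And>w. w \<in> {1..n} \<Longrightarrow> f w \<in> {0..n} \<and> d (f w) < d w"
    using rooted_imp_rank[OF assms] by blast
  have "w \<in> children (parent_edges n f) v \<longleftrightarrow> w \<in> {1..n} \<and> f w = v" for w
  proof
    assume w: "w \<in> children (parent_edges n f) v"
    then obtain x where x: "x \<in> {1..n}" "{v, w} = {f x, x}"
      unfolding children_def parent_edges_def by auto
    have "w \<in> {0..n}" using x d[of x] by (auto simp: doubleton_eq_iff)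
    then have "w \<in> {1..n}" using w by (simp add: children_def)
    moreover have "parent (parent_edges n f) w = v" using w by (simp add: children_def)
    ultimately show "w \<in> {1..n} \<and> f w = v" using parent_parent_edges[OF assms] by simp
  next
    assume w: "w \<in> {1..n} \<and> f w = v"
    then have "{v, w} \<in> parent_edges n f" using parent_edgesI[of w n f] by simp
    then show "w \<in> children (parent_edges n f) v"
      using w parent_parent_edges[OF assms, of w] by (simp add: children_def)
  qed
  then show ?thesis by blast
qed

section \<open>From trees to parent functions\<close>

text \<open>
  Let \<open>f w\<close> be the predecessor of \<open>w\<close> on a shortest path from \<open>0\<close>.  The edges
  \<open>{f w, w}\<close> already connect all vertices, so any further edge of the tree would close a cycle.
  This argument avoids proving uniqueness of paths in an acyclic graph.
\<close>

lemma tree_has_parent_function: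
  assumes "T \<in> trees n"
  obtains f where "rooted n f" "T = parent_edges n f"
proof -
  have sg: "\<And>e. e \<in> T \<Longrightarrow> e \<subseteq> {0..n} \<and> card e = 2"
    and conn: "\<And>v. v \<in> {0..n} \<Longrightarrow> \<exists>xs. path_from_to T 0 xs v"
    and acyc: "\<And>xs. \<not> is_cycle T xs"
    using assms unfolding trees_def is_tree_def simple_graph_def by auto
  define d where "d v = (LEAST k. \<exists>xs. path_from_to T 0 xs v \<and> length xs = k)" for v
  have "\<exists>u. {u, w} \<in> T \<and> u \<in> {0..n} \<and> d u < d w" if w: "w \<in> {1..n}" for w
  proof -
    have "\<exists>k xs. path_from_to T 0 xs w \<and> length xs = k" using conn[of w] w by auto
    then have "\<exists>xs. path_from_to T 0 xs w \<and> length xs = d w"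
      unfolding d_def by (rule LeastI_ex)
    then obtain xs where xs: "path_from_to T 0 xs w" "length xs = d w" by blast
    then have "xs \<noteq> []" by (auto simp: path_from_to_def is_path_def)
    then obtain ys where ys: "xs = ys @ [w]"
      using xs(1) by (metis append_butlast_last_id path_from_to_def)
    have "ys \<noteq> []" using xs(1) ys w by (auto simp: path_from_to_def)
    then have y: "path_from_to T 0 ys (last ys)" "{last ys, w} \<in> T"
      using xs(1) ys by (auto simp: path_from_to_def is_path_snoc)
    then have "d (last ys) \<le> length ys" unfolding d_def by (intro Least_le) blast
    then have "d (last ys) < d w" using xs(2) ys by simp
    then show ?thesis using y(2) sg by blast
  qed
  then obtain f where f: "\<And>w. w \<in> {1..n} \<Longrightarrow> {f w, w} \<in> T \<and> f w \<in> {0..n} \<and> d (f w) < d w"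
    by metis
  then have r: "rooted n f" by (intro rank_imp_rooted[of n f d]) blast
  have sub: "parent_edges n f \<subseteq> T" using f by (auto simp: parent_edges_def)
  have "e \<in> parent_edges n f" if e: "e \<in> T" for e
  proof (rule ccontr)
    assume ne: "e \<notin> parent_edges n f"
    obtain u v where uv: "e = {u, v}" "u \<noteq> v" using sg[OF e] by (meson card_2_iff)
    then have "u \<in> {0..n}" "v \<in> {0..n}" using sg[OF e] by auto
    then obtain xs where xs: "path_from_to (parent_edges n f) u xs v"
      using parent_edges_connected[OF r] by blast
    have "3 \<le> length xs"
    proof (rule ccontr)
      assume "\<not> 3 \<le> length xs"
      then consider "xs = []" | a where "xs = [a]" | a b where "xs = [a, b]"
        by (cases xs; cases "tl xs"; cases "tl (tl xs)") auto
      then show False using xs uv ne by cases (auto simp: path_from_to_def is_path_def)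
    qed
    then have "is_cycle T xs"
      using xs is_path_mono[OF _ sub] e uv
      by (auto simp: is_cycle_def path_from_to_def insert_commute)
    then show False using acyc by blast
  qed
  then show ?thesis using that r sub by blast
qed

section \<open>The involution on parent functions\<close>

text \<open>
  The effect of \<open>rho\<close> on a parent function, with \<open>p\<close> the parent of \<open>1\<close> and \<open>q\<close> the child of
  \<open>0\<close> above \<open>1\<close>.
\<close>

definition swap_children :: "nat \<Rightarrow> nat \<Rightarrow> (nat \<Rightarrow> nat) \<Rightarrow> nat \<Rightarrow> nat" where
  "swap_children p q f w =
     (if f w = 0 \<and> w \<noteq> q then p else if f w = p \<and> w \<noteq> 1 then 0 else f w)"

text \<open>
  Since \<open>p \<noteq> 0\<close>, the vertex \<open>1\<close> is no child of \<open>0\<close> and \<open>q\<close> is no child of \<open>p\<close>; so no vertex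
  moved in one direction is held fixed by the exception for the other direction.
\<close>

lemma swap_children_involution:
  assumes "p \<noteq> 0" "f q = 0" "f 1 = p"
  shows "swap_children p q (swap_children p q f) = f"
proof
  fix w
  consider (root) "f w = 0" | (p) "f w = p" | (other) "f w \<noteq> 0" "f w \<noteq> p" by blast
  then show "swap_children p q (swap_children p q f) w = f w"
  proof cases
    case root
    then have "w \<noteq> 1" using assms(1,3) by metis
    then show ?thesis using root assms(1,2) by (simp add: swap_children_def)
  next
    case p
    then have "w \<noteq> q" using assms(1,2) by metis
    then have "swap_children p q f w = (if w = 1 then p else 0)"
      using p assms(1,3) by (simp add: swap_children_def)
    then show ?thesis using p \<open>w \<noteq> q\<close> assms(1)
      by (cases "w = 1") (simp_all add: swap_children_def[of p q "swap_children p q f"])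
  next
    case other
    then show ?thesis by (simp add: swap_children_def)
  qed
qed

text \<open>
  The chain visits \<open>0\<close> and \<open>f 1\<close> once each.  Hence its only child of \<open>0\<close> is its second vertex and its
  only child of \<open>f 1\<close> is \<open>1\<close>, the two vertices that are not moved.
\<close>

lemma root_chain_swap_children:
  assumes "root_chain n f xs" "last xs = 1"
  shows "root_chain n (swap_children (f 1) (xs ! 1) f) xs"
proof -
  note pen = root_chain_penultimate[OF assms, simplified]
  have dist: "distinct xs" by (rule root_chain_distinct[OF assms(1)])
  have hd: "xs ! 0 = 0" using assms(1) by (metis root_chain_def hd_conv_nth)
  have "swap_children (f 1) (xs ! 1) f (xs ! Suc i) = xs ! i" if i: "Suc i < length xs" for i
  proof -
    have fi: "f (xs ! Suc i) = xs ! i" using assms(1) i by (simp add: root_chain_def)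
    have "xs ! Suc i = xs ! 1" if "xs ! i = 0"
    proof -
      have "i = 0" using that hd dist i nth_eq_iff_index_eq[of xs i 0] by fastforce
      then show ?thesis by simp
    qed
    moreover have "xs ! Suc i = 1" if "xs ! i = f 1"
    proof -
      have "i = length xs - 2"
        using that pen(1,3) dist i nth_eq_iff_index_eq[of xs i "length xs - 2"] by simp
      then have "Suc i = length xs - 1" using i by simp
      then show ?thesis using pen(4) by simp
    qed
    ultimately show ?thesis using fi by (auto simp: swap_children_def)
  qed
  then show ?thesis using assms(1) by (simp add: root_chain_def)
qed

text \<open>
  Induction on the old depth: the new parent of a vertex is its old parent, the root, or \<open>f 1\<close>,
  and the last of these has a new chain because it lies on the chain to \<open>1\<close>.
\<close>

lemma rooted_swap_children:
  assumes "rooted n f" "root_chain n f xs" "last xs = 1"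
  shows "rooted n (swap_children (f 1) (xs ! 1) f)" (is "rooted n ?g")
proof -
  obtain d :: "nat \<Rightarrow> nat" where d: "\<And>w. w \<in> {1..n} \<Longrightarrow> f w \<in> {0..n} \<and> d (f w) < d w"
    using rooted_imp_rank[OF assms(1)] by blast
  have gxs: "root_chain n ?g xs" by (rule root_chain_swap_children[OF assms(2,3)])
  have root: "\<exists>ys. root_chain n ?g ys \<and> last ys = 0"
    by (rule exI[of _ "[0]"]) simp
  have p: "\<exists>ys. root_chain n ?g ys \<and> last ys = f 1"
  proof -
    have "xs \<noteq> []" using gxs by (simp add: root_chain_def)
    then obtain ys where ys: "xs = ys @ [1]" using assms(3) by (metis append_butlast_last_id)
    then have "ys \<noteq> []" using gxs by auto
    then show ?thesis using gxs assms(2) ys root_chain_snoc by metis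
  qed
  have "v \<in> {0..n} \<Longrightarrow> \<exists>ys. root_chain n ?g ys \<and> last ys = v" for v
  proof (induction v rule: measure_induct_rule[of d])
    case (less v)
    show ?case
    proof (cases "v = 0")
      case True
      then show ?thesis using root by simp
    next
      case False
      then have v: "v \<in> {1..n}" using less.prems by auto
      have "?g v = f 1 \<or> ?g v = 0 \<or> ?g v = f v" by (simp add: swap_children_def)
      then have "\<exists>ys. root_chain n ?g ys \<and> last ys = ?g v"
        using p root less.IH[of "f v"] d[OF v] by metis
      then show ?thesis using rooted_step v by blast
    qed
  qed
  then show ?thesis unfolding rooted_def by blast
qed

text \<open>
  A vertex is determined by the edge to its parent, so removing the edges above \<open>A \<union> B\<close> leaves
  exactly the edges above the other vertices.
\<close>

lemma rho_parent_edges: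
  assumes "rooted n f" "root_chain n f xs" "last xs = 1" "f 1 \<noteq> 0"
  shows "rho (parent_edges n f) = parent_edges n (swap_children (f 1) (xs ! 1) f)"
proof -
  let ?T = "parent_edges n f" and ?p = "f 1" and ?q = "xs ! 1"
  let ?g = "swap_children ?p ?q f"
  obtain d :: "nat \<Rightarrow> nat" where d: "\<And>w. w \<in> {1..n} \<Longrightarrow> f w \<in> {0..n} \<and> d (f w) < d w"
    using rooted_imp_rank[OF assms(1)] by blast
  define A B where "A = {w \<in> {1..n}. f w = 0} - {?q}" and "B = {w \<in> {1..n}. f w = ?p} - {1}"
  have one: "1 \<in> {1..n}" using root_chain_penultimate(2)[OF assms(2,3)] by simp
  have par: "parent ?T 1 = ?p" by (rule parent_parent_edges[OF assms(1) one])
  have path: "root_path ?T 1 = xs" using root_path_parent_edges[OF assms(2)] assms(3) by simp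
  let ?e = "\<lambda>h w. {h w, w} :: nat set"
  have inj: "inj_on (?e f) {1..n}"
  proof (rule inj_onI)
    fix w t
    assume "w \<in> {1..n}" "t \<in> {1..n}" "{f w, w} = {f t, t}"
    then show "w = t" using d[of w] d[of t] by (auto simp: doubleton_eq_iff)
  qed
  have AB: "A \<subseteq> {1..n}" "B \<subseteq> {1..n}" by (auto simp: A_def B_def)
  have "rho ?T = (?T - ({{0, t} | t. t \<in> A} \<union> {{?p, s} | s. s \<in> B}))
      \<union> ({{?p, t} | t. t \<in> A} \<union> {{0, s} | s. s \<in> B})"
    unfolding rho_def Let_def par path children_parent_edges[OF assms(1)] A_def B_def
    using assms(4) by simp
  also have "{{0, t} | t. t \<in> A} = ?e f ` A"
    unfolding Setcompr_eq_image by (rule image_cong) (auto simp: A_def)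
  also have "{{?p, s} | s. s \<in> B} = ?e f ` B"
    unfolding Setcompr_eq_image by (rule image_cong) (auto simp: B_def)
  also have "{{?p, t} | t. t \<in> A} = ?e ?g ` A"
    unfolding Setcompr_eq_image by (rule image_cong) (auto simp: A_def swap_children_def)
  also have "{{0, s} | s. s \<in> B} = ?e ?g ` B"
    unfolding Setcompr_eq_image
    using assms(4) by (intro image_cong) (simp_all add: B_def swap_children_def)
  also have "?T - (?e f ` A \<union> ?e f ` B) = ?e f ` ({1..n} - (A \<union> B))"
    using inj_on_image_set_diff[OF inj, of "{1..n}" "A \<union> B"] AB
    by (simp add: parent_edges_def image_Un Diff_subset)
  also have "\<dots> = ?e ?g ` ({1..n} - (A \<union> B))"
    by (rule image_cong) (auto simp: A_def B_def swap_children_def)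
  also have "\<dots> \<union> (?e ?g ` A \<union> ?e ?g ` B) = ?e ?g ` (({1..n} - (A \<union> B)) \<union> (A \<union> B))"
    by (simp only: image_Un)
  also have "({1..n} - (A \<union> B)) \<union> (A \<union> B) = {1..n}" using AB by blast
  finally show ?thesis by (simp only: parent_edges_def)
qed

theorem mainTheorem7:
  fixes n :: nat
  assumes "n \<ge> 1"
  shows "\<forall>T\<in>trees n.
           rho T \<in> trees n \<and>
           rho (rho T) = T \<and>
           deg (rho T) 0 = deg T (parent T 1) \<and>
           deg (rho T) (parent (rho T) 1) = deg T 0 \<and>
           (\<forall>v\<in>{0..n} - {0, parent T 1}. children (rho T) v = children T v)"
proof
  fix T assume T: "T \<in> trees n"
  let ?goal = "rho T \<in> trees n \<and>
           rho (rho T) = T \<and>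
           deg (rho T) 0 = deg T (parent T 1) \<and>
           deg (rho T) (parent (rho T) 1) = deg T 0 \<and>
           (\<forall>v\<in>{0..n} - {0, parent T 1}. children (rho T) v = children T v)"
  obtain f where f: "rooted n f" "T = parent_edges n f"
    using tree_has_parent_function[OF T] by blast
  have one: "1 \<in> {1..n}" using assms by simp
  have par: "parent T 1 = f 1" using parent_parent_edges f one by simp
  show ?goal
  proof (cases "f 1 = 0")
    case True
    with par have "rho T = T" by (simp add: rho_def Let_def)
    then show ?thesis using T True par by simp
  next
    case False
    obtain xs where xs: "root_chain n f xs" "last xs = 1"
      using f(1) assms unfolding rooted_def by (metis atLeastAtMost_iff zero_le)
    define p q where "p = f 1" and "q = xs ! 1"
    have q: "q \<in> {1..n}" "f q = 0"
      using xs(1) root_chain_penultimate(1)[OF xs]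
      by (auto simp: root_chain_def q_def hd_conv_nth)
    define g where "g = swap_children p q f"
    have g1: "g 1 = p" using False by (simp add: g_def swap_children_def p_def)
    have rho: "rho T = parent_edges n g"
      using rho_parent_edges[OF f(1) xs False] f(2) by (simp add: g_def p_def q_def)
    have g: "rooted n g" "root_chain n g xs"
      using rooted_swap_children[OF f(1) xs] root_chain_swap_children[OF xs]
      by (simp_all add: g_def p_def q_def)
    \<comment> \<open>The chain \<open>xs\<close> also serves the new tree, so the second application has the same \<open>p\<close> and \<open>q\<close>.\<close>
    have "swap_children p q g = f"
      using False q(2) by (simp add: g_def p_def swap_children_involution)
    then have "swap_children (g 1) (xs ! 1) g = f" unfolding g1 q_def .
    then have inv: "rho (rho T) = T"
      using rho_parent_edges[OF g xs(2)] g1 False rho f(2) by (simp add: p_def)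
    have parg: "parent (rho T) 1 = p" using parent_parent_edges g(1) one rho g1 by simp
    have ch: "children T v = {w \<in> {1..n}. f w = v}" "children (rho T) v = {w \<in> {1..n}. g w = v}" for v
      using children_parent_edges f g(1) rho by auto
    have fin: "finite (children T v)" for v using ch(1)[of v] by simp
    have "children (rho T) 0 = insert q (children T p - {1})"
      unfolding ch using False q by (auto simp: g_def swap_children_def p_def)
    moreover have "q \<notin> children T p" "1 \<in> children T p"
      using False q one by (auto simp: ch p_def)
    ultimately have deg0: "deg (rho T) 0 = deg T p"
      using fin[of p] by (simp add: deg_def card.insert_remove card_Suc_Diff1 del: card_Diff_insert)
    have "children (rho T) p = insert 1 (children T 0 - {q})"
      unfolding ch using False q one by (auto simp: g_def swap_children_def p_def)
    moreover have "1 \<notin> children T 0" "q \<in> children T 0"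
      using False q one by (auto simp: ch p_def)
    ultimately have degp: "deg (rho T) p = deg T 0"
      using fin[of 0] by (simp add: deg_def card.insert_remove card_Suc_Diff1 del: card_Diff_insert)
    have "children (rho T) v = children T v" if "v \<notin> {0, p}" for v
      unfolding ch using that by (auto simp: g_def swap_children_def)
    then show ?thesis
      using parent_edges_tree[OF g(1)] rho inv deg0 degp par parg by (simp add: p_def)
  qed
qed

end
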